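(* Let $\underline{S_2}=\lambda n\lambda f\lambda x ((n)f)(f)x$. There is an $\underline{S_2}$-storage operator which is not a storage operator.
   Context: Notation: $(t)u$ denotes application of $t$ to $u$, and $(t)u_1\dots u_n$ stands for $(\dots((t)u_1)\dots)u_n$; $\overline{c}$ denotes a finite sequence of terms. $u \succ v$ means $v$ is obtained from $u$ by finitely many head-reduction steps. $(u)^0v=v$, $(u)^{n+1}v=(u)(u)^nv$. Church integers: $\underline{n}=\lambda f\lambda x (f)^n x$. A closed $\lambda$-term $\underline{S}$ is a successor iff $(\underline{S})\underline{k}\simeq_\beta \underline{k+1}$ for every $k\ge 0$ ($\underline{S_2}$ is a successor). A closed $\lambda$-term $T$ is a storage operator iff for every $n\ge 0$ there is a closed $\lambda$-term $\tau_n\simeq_\beta \underline{n}$ such that for every $\theta_n\simeq_\beta\underline{n}$, $(T)\theta_n f \succ (f)\tau_n$ (where $f$ is a fresh variable). $\lambda X$-terms: terms built from variables and constants $X_i$ ($i\ge 0$) by abstraction and application, together with constants $X_{n,a,b,\overline{c}}$ for every $n\in\mathbb N$ and $\lambda X$-terms $a,b,\overline{c}$ ($X_{n,a,b,\overline{c}}$ is regarded as a constant not occurring in $a,b,\overline{c}$). Given a successor $\underline{S}$, a closed $\lambda$-term $T$ is an $\underline{S}$-storage operator iff for every $n\ge 0$ there is a finite sequence of head reductions $U_i\succ V_i$ ($1\le i\le r$) such that: (1) all $U_i,V_i$ are $\lambda X$-terms; (2) $U_1=(T)X_n f$ and $V_r=(f)\tau_n$ with $\tau_n$ a closed $\lambda$-term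 $\beta$-equivalent to $\underline{n}$; (3) for $i<r$, $V_i=(X_n)ab\overline{c}$ or $V_i=(X_{l,a,b,\overline{c}})uv\overline{w}$ with $0\le l\le n-1$; (4) if $V_i=(X_n)ab\overline{c}$ then $U_{i+1}=(\underline{0})ab\overline{c}$ if $n=0$ and $U_{i+1}=((\underline{S})X_{n-1,a,b,\overline{c}})ab\overline{c}$ if $n\ne 0$; (5) if $V_i=(X_{l,a,b,\overline{c}})uv\overline{w}$ then $U_{i+1}=(\underline{0})uv\overline{w}$ if $l=0$ and $U_{i+1}=((\underline{S})X_{l-1,u,v,\overline{w}})uv\overline{w}$ if $l\ne 0$. *)

theory Defs
  imports Main
begin

text \<open>
  Terms are in de Bruijn notation, over a type of constants. Constants are inert: lifting,
  substitution, reduction and free variables do not look inside them. The \<open>\<lambda>\<close>-terms are the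
  terms in which no constant occurs.
\<close>

datatype (csts: 'c) trm =
    Var nat
  | Const 'c
  | App "'c trm" "'c trm"
  | Lam "'c trm"

abbreviation apps :: "'c trm \<Rightarrow> 'c trm list \<Rightarrow> 'c trm" where
  "apps t us \<equiv> foldl App t us"

primrec fv :: "'c trm \<Rightarrow> nat set" where
  "fv (Var i) = {i}"
| "fv (Const c) = {}"
| "fv (App t u) = fv t \<union> fv u"
| "fv (Lam t) = {i. Suc i \<in> fv t}"

definition lambda_term :: "'c trm \<Rightarrow> bool" where
  "lambda_term t \<longleftrightarrow> csts t = {}"

definition closed_lambda_term :: "'c trm \<Rightarrow> bool" where
  "closed_lambda_term t \<longleftrightarrow> lambda_term t \<and> fv t = {}"

primrec lift :: "'c trm \<Rightarrow> nat \<Rightarrow> 'c trm" where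
  "lift (Var i) k = (if i < k then Var i else Var (Suc i))"
| "lift (Const c) k = Const c"
| "lift (App t u) k = App (lift t k) (lift u k)"
| "lift (Lam t) k = Lam (lift t (Suc k))"

text \<open>\<open>subst t s k\<close> replaces the variable \<open>k\<close> by \<open>s\<close> and decrements the variables above \<open>k\<close>.\<close>

primrec subst :: "'c trm \<Rightarrow> 'c trm \<Rightarrow> nat \<Rightarrow> 'c trm" where
  "subst (Var i) s k = (if k < i then Var (i - 1) else if i = k then s else Var i)"
| "subst (Const c) s k = Const c"
| "subst (App t u) s k = App (subst t s k) (subst u s k)"
| "subst (Lam t) s k = Lam (subst t (lift s 0) (Suc k))"

inductive beta :: "'c trm \<Rightarrow> 'c trm \<Rightarrow> bool" where
  "beta (App (Lam t) u) (subst t u 0)"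
| "beta t t' \<Longrightarrow> beta (App t u) (App t' u)"
| "beta u u' \<Longrightarrow> beta (App t u) (App t u')"
| "beta t t' \<Longrightarrow> beta (Lam t) (Lam t')"

text \<open>
  Between \<open>\<lambda>\<close>-terms this is the usual \<open>\<beta>\<close>-equivalence: constants occurring in intermediate terms
  can be replaced throughout by a closed \<open>\<lambda>\<close>-term.
\<close>

definition beta_eq :: "'c trm \<Rightarrow> 'c trm \<Rightarrow> bool" (infix "\<simeq>\<^sub>\<beta>" 50) where
  "beta_eq = equivclp beta"

text \<open>
  One head-reduction step contracts the redex \<open>(\<lambda>x. t) u\<close> in
  \<open>\<lambda>x\<^sub>1 \<dots> x\<^sub>k. (\<lambda>x. t) u v\<^sub>1 \<dots> v\<^sub>m\<close>; the side condition below keeps the contracted redex at the head.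
\<close>

inductive head_step :: "'c trm \<Rightarrow> 'c trm \<Rightarrow> bool" where
  "head_step (App (Lam t) u) (subst t u 0)"
| "head_step t t' \<Longrightarrow> (\<And>s. t \<noteq> Lam s) \<Longrightarrow> head_step (App t u) (App t' u)"
| "head_step t t' \<Longrightarrow> head_step (Lam t) (Lam t')"

definition head_red :: "'c trm \<Rightarrow> 'c trm \<Rightarrow> bool" (infix "\<succ>" 50) where
  "head_red = head_step\<^sup>*\<^sup>*"

definition church :: "nat \<Rightarrow> 'c trm" where
  "church n = Lam (Lam ((App (Var 1) ^^ n) (Var 0)))"

definition successor :: "'c trm \<Rightarrow> bool" where
  "successor S \<longleftrightarrow> closed_lambda_term S \<and> (\<forall>k. App S (church k) \<simeq>\<^sub>\<beta> church (k + 1))"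

text \<open>\<open>\<lambda>n f x. ((n) f) (f) x\<close>\<close>

definition S2 :: "'c trm" where
  "S2 = Lam (Lam (Lam (App (App (Var 2) (Var 1)) (App (Var 1) (Var 0)))))"

text \<open>The \<open>\<theta>\<close> below need not be closed, so the fresh variable depends on \<open>\<theta>\<close>.\<close>

definition storage_operator :: "'c trm \<Rightarrow> bool" where
  "storage_operator T \<longleftrightarrow> closed_lambda_term T \<and>
     (\<forall>n. \<exists>\<tau>. closed_lambda_term \<tau> \<and> \<tau> \<simeq>\<^sub>\<beta> church n \<and>
        (\<forall>\<theta> f. lambda_term \<theta> \<longrightarrow> \<theta> \<simeq>\<^sub>\<beta> church n \<longrightarrow> f \<notin> fv \<theta> \<longrightarrow>
           App (App T \<theta>) (Var f) \<succ> App (Var f) \<tau>))"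

text \<open>\<open>X n\<close> is $X_n$ and \<open>XA n a b cs\<close> is $X_{n,a,b,\overline{c}}$.\<close>

datatype xconst =
    X nat
  | XA nat "xconst trm" "xconst trm" "xconst trm list"

type_synonym lambdaX_term = "xconst trm"

text \<open>
  The sequences $U_i$, $V_i$ are used for $1 \le i \le r$ only. As \<open>T\<close> is closed, \<open>Var 0\<close> can
  serve as the fresh variable $f$. The bound $l \le n - 1$ is one of integers, that is \<open>l < n\<close>.
\<close>

definition S_storage_operator :: "lambdaX_term \<Rightarrow> lambdaX_term \<Rightarrow> bool" where
  "S_storage_operator S T \<longleftrightarrow> successor S \<and> closed_lambda_term T \<and>
     (\<forall>n. \<exists>(r::nat) U V \<tau>. 1 \<le> r \<and>
        (\<forall>i\<in>{1..r}. U i \<succ> V i) \<and>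
        U 1 = App (App T (Const (X n))) (Var 0) \<and>
        V r = App (Var 0) \<tau> \<and> closed_lambda_term \<tau> \<and> \<tau> \<simeq>\<^sub>\<beta> church n \<and>
        (\<forall>i\<in>{1..<r}.
           (\<exists>a b cs. V i = apps (Const (X n)) (a # b # cs)) \<or>
           (\<exists>l a b cs u v ws. l < n \<and> V i = apps (Const (XA l a b cs)) (u # v # ws))) \<and>
        (\<forall>i\<in>{1..<r}. \<forall>a b cs. V i = apps (Const (X n)) (a # b # cs) \<longrightarrow>
           U (i + 1) = (if n = 0 then apps (church 0) (a # b # cs)
                        else apps (App S (Const (XA (n - 1) a b cs))) (a # b # cs))) \<and>
        (\<forall>i\<in>{1..<r}. \<forall>l a b cs u v ws. V i = apps (Const (XA l a b cs)) (u # v # ws) \<longrightarrow>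
           U (i + 1) = (if l = 0 then apps (church 0) (u # v # ws)
                        else apps (App S (Const (XA (l - 1) u v ws))) (u # v # ws))))"

end

theory Submission imports Defs begin

text \<open>
  Let \<open>A = \<lambda>t g. (g) (S2) (t) I\<close> and \<open>B = \<lambda>g. (g) 0\<close>, so that \<open>((A)\<^sup>n B) I\<close> is \<open>\<beta>\<close>-equivalent to
  the Church integer of \<open>n\<close>. The witness is \<open>T = \<lambda>\<nu>. (\<nu>) A B\<close>. Driven by \<open>S2\<close>, the constants only
  accumulate the literal argument \<open>(A)\<^sup>n B\<close>, which finally comes to the head and delivers
  \<open>(f) (S2) ((A)\<^sup>n\<^sup>-\<^sup>1 B) I\<close>. For an arbitrary \<open>\<theta> = \<lambda>g x. (g) t\<close>, however, the term \<open>t[A/g, B/x]\<close>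
  is passed to \<open>f\<close> unevaluated, and \<open>\<lambda>g x. (g) x\<close> and \<open>\<lambda>g x. (g) (I) x\<close> give distinct results.
\<close>

section \<open>Closed terms and substitution\<close>

text \<open>Closedness is lost on passing under a binder, so the induction runs on a bound
  \<open>k\<close> for the free variables, which grows by one there. Closed terms satisfy every
  bound.\<close>

lemma lift_bounded: "(\<forall>i\<in>fv t. i < k) \<Longrightarrow> lift t k = t"
proof (induction t arbitrary: k)
  case (Lam t)
  have "\<forall>i\<in>fv t. i < Suc k"
  proof
    fix i assume "i \<in> fv t"
    with Lam.prems show "i < Suc k" by (cases i) auto
  qed
  then show ?case using Lam.IH by simp
qed auto

lemma subst_bounded: "(\<forall>i\<in>fv t. i < k) \<Longrightarrow> subst t s k = t"
proof (induction t arbitrary: k s)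
  case (Lam t)
  have "\<forall>i\<in>fv t. i < Suc k"
  proof
    fix i assume "i \<in> fv t"
    with Lam.prems show "i < Suc k" by (cases i) auto
  qed
  then show ?case using Lam.IH by simp
qed auto

lemma lift_closed: "fv t = {} \<Longrightarrow> lift t k = t"
  by (simp add: lift_bounded)

lemma subst_closed: "fv t = {} \<Longrightarrow> subst t s k = t"
  by (simp add: subst_bounded)

lemma subst_App_funpow:
  "subst ((App t ^^ n) u) s k = (App (subst t s k) ^^ n) (subst u s k)"
  by (induction n) auto

lemma fv_App_funpow_closed: "fv t = {} \<Longrightarrow> fv u = {} \<Longrightarrow> fv ((App t ^^ n) u) = {}"
  by (induction n) auto

lemma csts_App_funpow: "csts t = {} \<Longrightarrow> csts u = {} \<Longrightarrow> csts ((App t ^^ n) u) = {}"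
  by (induction n) auto

text \<open>The spine of a term is unique. Conditions on a sequence quantify over all decompositions
  of \<open>V i\<close>; this reduces them to the one by which \<open>V i\<close> is built.\<close>

lemma apps_Const_inject:
  "apps (Const c) us = apps (Const d) vs \<longleftrightarrow> c = d \<and> us = vs"
proof (induction us arbitrary: vs rule: rev_induct)
  case Nil
  then show ?case by (cases vs rule: rev_cases) auto
next
  case (snoc u us)
  then show ?case by (cases vs rule: rev_cases) auto
qed

section \<open>Reduction\<close>

lemma beta_eq_refl [simp]: "t \<simeq>\<^sub>\<beta> t"
  by (simp add: beta_eq_def)

lemma beta_eq_trans [trans]: "t \<simeq>\<^sub>\<beta> u \<Longrightarrow> u \<simeq>\<^sub>\<beta> v \<Longrightarrow> t \<simeq>\<^sub>\<beta> v"
  unfolding beta_eq_def by (rule equivclp_trans)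

lemma beta_imp_beta_eq: "beta t u \<Longrightarrow> t \<simeq>\<^sub>\<beta> u"
  unfolding beta_eq_def by (rule r_into_equivclp)

lemma beta_eq_redex: "subst t u 0 = v \<Longrightarrow> App (Lam t) u \<simeq>\<^sub>\<beta> v"
  using beta.intros(1) beta_imp_beta_eq by blast

lemma beta_eq_compatible:
  assumes "\<And>t u. beta t u \<Longrightarrow> beta (C t) (C u)" and "t \<simeq>\<^sub>\<beta> u"
  shows "C t \<simeq>\<^sub>\<beta> C u"
  using assms(2) unfolding beta_eq_def
proof (induction rule: equivclp_induct)
  case base
  then show ?case by simp
next
  case (step y z)
  then have "equivclp beta (C y) (C z)"
    using assms(1) by (metis equivclp_sym r_into_equivclp)
  with step.IH show ?case by (rule equivclp_trans)
qed

lemma beta_eq_App: "t \<simeq>\<^sub>\<beta> t' \<Longrightarrow> u \<simeq>\<^sub>\<beta> u' \<Longrightarrow> App t u \<simeq>\<^sub>\<beta> App t' u'"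
  by (meson beta_eq_trans beta_eq_compatible[of "\<lambda>t. App t u"] beta_eq_compatible[of "App t'"]
      beta.intros(2,3))

lemma beta_eq_Lam: "t \<simeq>\<^sub>\<beta> t' \<Longrightarrow> Lam t \<simeq>\<^sub>\<beta> Lam t'"
  by (rule beta_eq_compatible) (rule beta.intros(4))

text \<open>An abstraction in function position may itself have a head step; the side condition of
  the application rule forbids taking it, so the rules do not overlap.\<close>

lemma head_step_deterministic: "head_step t u \<Longrightarrow> head_step t v \<Longrightarrow> u = v"
proof (induction arbitrary: v rule: head_step.induct)
  case (1 t u)
  then show ?case by (cases rule: head_step.cases) blast+
next
  case (2 t t' u)
  from 2(4) show ?case
  proof (cases rule: head_step.cases)
    case (1 s)
    with 2(2) show ?thesis by blast
  next
    case (2 t'')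
    with "2.IH" show ?thesis by blast
  qed
next
  case (3 t t')
  from 3(3) show ?case
  proof (cases rule: head_step.cases)
    case (3 t'')
    with "3.IH" show ?thesis by blast
  qed
qed

lemma head_normal_App_Var: "\<not> head_step (App (Var i) t) u"
  by (auto elim: head_step.cases)

text \<open>\<open>App (Var i) u\<close> is head normal and head reduction is deterministic, so a
  term reaches at most one such form. This pins down the stored term literally, not just up to
  \<beta>-equivalence.\<close>

lemma head_red_App_Var_unique:
  assumes "t \<succ> App (Var i) u" and "t \<succ> App (Var i) v"
  shows "u = v"
  using assms unfolding head_red_def
proof (induction rule: converse_rtranclp_induct)
  case base
  then show ?case
    by (metis converse_rtranclpE head_normal_App_Var trm.inject(3))
next
  case (step y z)
  then show ?case
    by (metis converse_rtranclpE head_normal_App_Var head_step_deterministic)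
qed

section \<open>Computing with head reduction\<close>

lemma head_red_refl [simp]: "t \<succ> t"
  by (simp add: head_red_def)

lemma head_red_trans: "t \<succ> u \<Longrightarrow> u \<succ> v \<Longrightarrow> t \<succ> v"
  by (simp add: head_red_def)

lemma head_step_imp_beta_eq:
  "head_step t u \<Longrightarrow> t \<simeq>\<^sub>\<beta> u"
proof (induction rule: head_step.induct)
  case (1 t u)
  show ?case by (rule beta_eq_redex) (rule refl)
qed (simp_all add: beta_eq_App beta_eq_Lam)

lemma head_red_imp_beta_eq: "t \<succ> u \<Longrightarrow> t \<simeq>\<^sub>\<beta> u"
  unfolding head_red_def
proof (induction rule: rtranclp_induct)
  case (step y z)
  then show ?case using beta_eq_trans head_step_imp_beta_eq by blast
qed simp

lemma head_step_apps_redex: "head_step (apps (App (Lam t) u) us) (apps (subst t u 0) us)"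
proof (induction us rule: rev_induct)
  case Nil
  show ?case by (simp add: head_step.intros(1))
next
  case (snoc v us)
  have "apps (App (Lam t) u) us \<noteq> Lam s" for s
    by (cases us rule: rev_cases) auto
  with snoc.IH show ?case by (simp add: head_step.intros(2))
qed

text \<open>Prefixes a reduction with one contraction, so that a concrete head reduction is computed
  by one rule application per redex.\<close>

lemma head_red_apps_redex:
  assumes "apps (subst t u 0) us \<succ> v"
  shows "apps (App (Lam t) u) us \<succ> v"
  using assms unfolding head_red_def
  by (rule converse_rtranclp_into_rtranclp[of head_step, OF head_step_apps_redex])

lemmas head_red_redex0 = head_red_apps_redex[where us = "[]", simplified]
lemmas head_red_redex1 = head_red_apps_redex[where us = "[v]" for v, simplified]
lemmas head_red_redex2 = head_red_apps_redex[where us = "[v, w]" for v w, simplified]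

lemma head_red_church_0: "App (App (App (church 0) a) b) d \<succ> App b d"
  unfolding church_def
  by (rule head_red_redex2, simp, rule head_red_redex1, simp)

text \<open>The second argument grows from \<open>b\<close> to \<open>App a b\<close>: each pass
  through \<open>S2\<close> accumulates one \<open>a\<close>. Only \<open>a\<close> is substituted
  under a binder, so closedness is required of it alone; \<open>c\<close> is inert even if variables
  occur in its indices.\<close>

lemma head_red_S2:
  assumes "fv a = {}"
  shows "App (App (App (App S2 (Const c)) a) b) d \<succ> App (App (App (Const c) a) (App a b)) d"
  unfolding S2_def
  by (rule head_red_apps_redex[where us = "[a, b, d]" for a b d, simplified], simp,
      rule head_red_redex2, simp, rule head_red_redex1, simp add: assms lift_closed subst_closed)

section \<open>Successors\<close>

lemma fv_church: "fv (church n) = {}"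
proof -
  have "fv ((App (Var 1) ^^ n) (Var 0)) \<subseteq> {0, 1}"
    by (induction n) auto
  then show ?thesis by (auto simp: church_def)
qed

lemma S2_church: "App S2 (church k) \<simeq>\<^sub>\<beta> church (Suc k)"
proof -
  have "App S2 (church k) \<simeq>\<^sub>\<beta>
      Lam (Lam (App (App (church k) (Var 1)) (App (Var 1) (Var 0))))"
    unfolding S2_def
    by (rule beta_eq_redex) (simp add: lift_closed fv_church)
  also have "\<dots> \<simeq>\<^sub>\<beta> Lam (Lam ((App (Var 1) ^^ k) (App (Var 1) (Var 0))))"
  proof (intro beta_eq_Lam)
    have "App (church k) (Var 1) \<simeq>\<^sub>\<beta> Lam ((App (Var (Suc (Suc 0))) ^^ k) (Var 0))"
      unfolding church_def by (rule beta_eq_redex) (simp add: subst_App_funpow)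
    then have "App (App (church k) (Var 1)) (App (Var 1) (Var 0)) \<simeq>\<^sub>\<beta>
        App (Lam ((App (Var (Suc (Suc 0))) ^^ k) (Var 0))) (App (Var 1) (Var 0))"
      by (rule beta_eq_App) simp
    also have "\<dots> \<simeq>\<^sub>\<beta> (App (Var 1) ^^ k) (App (Var 1) (Var 0))"
      by (rule beta_eq_redex) (simp add: subst_App_funpow)
    finally show "App (App (church k) (Var 1)) (App (Var 1) (Var 0)) \<simeq>\<^sub>\<beta>
        (App (Var 1) ^^ k) (App (Var 1) (Var 0))" .
  qed
  \<comment> \<open>\<open>S2\<close> adds its application innermost, whereas \<open>church\<close>
    unfolds outermost; iterates of one function commute.\<close>
  also have "\<dots> = church (Suc k)"
    by (simp add: church_def funpow_swap1)
  finally show ?thesis .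
qed

lemma closed_S2: "csts S2 = {}" "fv S2 = {}"
  by (simp_all add: S2_def)

lemma successor_S2: "successor S2"
  by (simp add: successor_def closed_lambda_term_def lambda_term_def closed_S2 S2_church)

section \<open>The witness\<close>

definition identity :: "'c trm" where
  "identity = Lam (Var 0)"

text \<open>Successor on integers wrapped as \<lambda>g. (g) k: applying the argument to
  \<open>identity\<close> unwraps it, and the result is wrapped again. \<open>baseB\<close> is the
  wrapped zero.\<close>

definition stepA :: "'c trm" where
  "stepA = Lam (Lam (App (Var 0) (App S2 (App (Var 1) identity))))"

definition baseB :: "'c trm" where
  "baseB = Lam (App (Var 0) (church 0))"

definition witness :: "'c trm" where
  "witness = Lam (App (App (Var 0) stepA) baseB)"

abbreviation iter :: "nat \<Rightarrow> 'c trm" where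
  "iter n \<equiv> (App stepA ^^ n) baseB"

text \<open>The content wrapped by \<open>iter n\<close>, left unevaluated: only the outermost layer
  is exposed.\<close>

definition stored :: "nat \<Rightarrow> 'c trm" where
  "stored n = (case n of 0 \<Rightarrow> church 0 | Suc m \<Rightarrow> App S2 (App (iter m) identity))"

lemma closed_identity: "csts identity = {}" "fv identity = {}"
  by (simp_all add: identity_def)

lemma closed_stepA: "csts stepA = {}" "fv stepA = {}"
  by (simp_all add: stepA_def closed_S2 closed_identity)

lemma closed_baseB: "csts baseB = {}" "fv baseB = {}"
  by (simp_all add: baseB_def church_def)

lemma closed_witness: "csts witness = {}" "fv witness = {}"
  by (simp_all add: witness_def closed_stepA closed_baseB)

lemma closed_iter: "csts (iter n) = {}" "fv (iter n) = {}"
  by (simp_all add: csts_App_funpow fv_App_funpow_closed closed_stepA closed_baseB)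

lemma closed_stored: "closed_lambda_term (stored n)"
  by (cases n)
    (simp_all add: stored_def closed_lambda_term_def lambda_term_def church_def
      closed_S2 closed_identity closed_iter)

section \<open>Head reduction of the iterates and the value they store\<close>

lemma head_red_stepA:
  assumes "fv t = {}"
  shows "App (App stepA t) u \<succ> App u (App S2 (App t identity))"
  unfolding stepA_def
  by (rule head_red_redex1, simp, rule head_red_redex0,
      simp add: assms lift_closed subst_closed closed_S2 closed_identity)

lemma head_red_baseB: "App baseB u \<succ> App u (church 0)"
  unfolding baseB_def
  by (rule head_red_redex0) (simp add: church_def)

text \<open>A case distinction suffices: head reduction opens the outermost \<open>stepA\<close>
  only, and the inner iterate stays intact inside \<open>stored n\<close>.\<close>

lemma head_red_iter: "App (iter n) u \<succ> App u (stored n)"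
  by (cases n) (simp_all add: stored_def head_red_baseB head_red_stepA closed_iter)

lemma iter_identity: "App (iter n) identity \<simeq>\<^sub>\<beta> stored n"
proof -
  have "App (iter n) identity \<simeq>\<^sub>\<beta> App identity (stored n)"
    by (intro head_red_imp_beta_eq head_red_iter)
  also have "\<dots> \<simeq>\<^sub>\<beta> stored n"
    unfolding identity_def by (rule beta_eq_redex) simp
  finally show ?thesis .
qed

lemma stored_beta_eq: "(stored n :: 'c trm) \<simeq>\<^sub>\<beta> church n"
proof (induction n)
  case 0
  show ?case by (simp add: stored_def)
next
  case (Suc n)
  have "(stored (Suc n) :: 'c trm) = App S2 (App (iter n) identity)"
    by (simp add: stored_def)
  also have "\<dots> \<simeq>\<^sub>\<beta> App S2 (church n)"
    by (rule beta_eq_App[OF beta_eq_refl beta_eq_trans[OF iter_identity Suc.IH]])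
  also have "\<dots> \<simeq>\<^sub>\<beta> church (Suc n)"
    by (rule S2_church)
  finally show ?case .
qed

lemma head_red_witness:
  "App (App witness t) u \<succ> App (App (App t stepA) baseB) u"
  unfolding witness_def
  by (rule head_red_redex1)
    (simp add: subst_closed closed_stepA closed_baseB)

lemma S_storage_operator_witness: "S_storage_operator S2 witness"
  unfolding S_storage_operator_def
proof (intro conjI allI)
  show "successor S2" by (rule successor_S2)
  show "closed_lambda_term witness"
    by (simp add: closed_lambda_term_def lambda_term_def closed_witness)
  fix n
  \<comment> \<open>\<open>c j\<close> is the constant at the head of \<open>V (j + 1)\<close>. Its
    integer index falls from \<open>n\<close> to 0 as \<open>j\<close> runs from 0 to
    \<open>n\<close>, so there are \<open>n + 1\<close> such terms and the sequence has length
    \<open>n + 2\<close>.\<close>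
  define c where "c j = (case j of 0 \<Rightarrow> X n | Suc i \<Rightarrow> XA (n - j) stepA (iter i) [Var 0])" for j
  define V where "V i = (if i = n + 2 then App (Var 0) (stored n)
      else apps (Const (c (i - 1))) [stepA, iter (i - 1), Var 0])" for i
  \<comment> \<open>\<open>U i\<close> repeats the arguments of \<open>V (i - 1)\<close>, hence
    \<open>iter (i - 2)\<close>; reducing \<open>S2\<close> then yields \<open>iter (i - 1)\<close>.
    At \<open>i = n + 2\<close> the integer 0 discards \<open>stepA\<close> and brings
    \<open>iter n\<close> to the head.\<close>
  define U where "U i = (if i = 1 then App (App witness (Const (X n))) (Var 0)
      else if i = n + 2 then apps (church 0) [stepA, iter n, Var 0]
      else apps (App S2 (Const (c (i - 1)))) [stepA, iter (i - 2), Var 0])" for i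
  have red: "U i \<succ> V i" if "i \<in> {1..n + 2}" for i
  proof -
    consider "i = 1" | "i = n + 2" | j where "i \<noteq> n + 2" "i = Suc (Suc j)"
      using \<open>i \<in> {1..n + 2}\<close> by (cases i; cases "i - 1") auto
    then show ?thesis
    proof cases
      case 1
      then show ?thesis
        using head_red_witness by (simp add: U_def V_def c_def)
    next
      case 2
      then show ?thesis
        using head_red_trans[OF head_red_church_0 head_red_iter] by (simp add: U_def V_def)
    next
      case 3
      then show ?thesis
        by (auto simp: U_def V_def head_red_S2 closed_stepA)
    qed
  qed
  have V: "V i = apps (Const (c (i - 1))) [stepA, iter (i - 1), Var 0]" if "i \<in> {1..<n + 2}" for i
    using that by (simp add: V_def)
  show "\<exists>(r::nat) U V \<tau>. 1 \<le> r \<and>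
        (\<forall>i\<in>{1..r}. U i \<succ> V i) \<and>
        U 1 = App (App witness (Const (X n))) (Var 0) \<and>
        V r = App (Var 0) \<tau> \<and> closed_lambda_term \<tau> \<and> \<tau> \<simeq>\<^sub>\<beta> church n \<and>
        (\<forall>i\<in>{1..<r}.
           (\<exists>a b cs. V i = apps (Const (X n)) (a # b # cs)) \<or>
           (\<exists>l a b cs u v ws. l < n \<and> V i = apps (Const (XA l a b cs)) (u # v # ws))) \<and>
        (\<forall>i\<in>{1..<r}. \<forall>a b cs. V i = apps (Const (X n)) (a # b # cs) \<longrightarrow>
           U (i + 1) = (if n = 0 then apps (church 0) (a # b # cs)
                        else apps (App S2 (Const (XA (n - 1) a b cs))) (a # b # cs))) \<and>
        (\<forall>i\<in>{1..<r}. \<forall>l a b cs u v ws. V i = apps (Const (XA l a b cs)) (u # v # ws) \<longrightarrow>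
           U (i + 1) = (if l = 0 then apps (church 0) (u # v # ws)
                        else apps (App S2 (Const (XA (l - 1) u v ws))) (u # v # ws)))"
  proof (rule exI[of _ "n + 2"], rule exI[of _ U], rule exI[of _ V], rule exI[of _ "stored n"],
      intro conjI ballI allI impI)
    fix i assume i: "i \<in> {1..<n + 2}"
    show "(\<exists>a b cs. V i = apps (Const (X n)) (a # b # cs)) \<or>
        (\<exists>l a b cs u v ws. l < n \<and> V i = apps (Const (XA l a b cs)) (u # v # ws))"
    proof (cases "i - 1")
      case 0
      with V[OF i] show ?thesis by (metis c_def nat.case(1))
    next
      case (Suc j)
      with i have "n - Suc j < n" by auto
      moreover from Suc have "c (i - 1) = XA (n - Suc j) stepA (iter j) [Var 0]"
        by (simp add: c_def)
      ultimately show ?thesis using V[OF i] by metis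
    qed
  next
    fix i a b cs
    assume i: "i \<in> {1..<n + 2}" and "V i = apps (Const (X n)) (a # b # cs)"
    then have "apps (Const (c (i - 1))) [stepA, iter (i - 1), Var 0] =
        apps (Const (X n)) (a # b # cs)"
      using V[OF i] by argo
    then have c: "c (i - 1) = X n" and eqs: "a = stepA" "b = iter (i - 1)" "cs = [Var 0]"
      unfolding apps_Const_inject by blast+
    \<comment> \<open>Only \<open>c 0\<close> has the form \<open>X n\<close>.\<close>
    from c have "i = 1" using i by (auto simp: c_def split: nat.splits)
    with eqs show "U (i + 1) = (if n = 0 then apps (church 0) (a # b # cs)
        else apps (App S2 (Const (XA (n - 1) a b cs))) (a # b # cs))"
      by (simp add: U_def c_def)
  next
    fix i l a b cs u v ws
    assume i: "i \<in> {1..<n + 2}" and "V i = apps (Const (XA l a b cs)) (u # v # ws)"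
    then have "apps (Const (c (i - 1))) [stepA, iter (i - 1), Var 0] =
        apps (Const (XA l a b cs)) (u # v # ws)"
      using V[OF i] by argo
    then have c: "c (i - 1) = XA l a b cs"
      and eqs: "u = stepA" "v = iter (i - 1)" "ws = [Var 0]"
      unfolding apps_Const_inject by blast+
    from c obtain j where "i - 1 = Suc j" and l: "l = n - Suc j"
      by (auto simp: c_def split: nat.splits)
    then have "i = Suc (Suc j)" by simp
    \<comment> \<open>Here \<open>Suc j \<le> n\<close>, so the subtraction is exact and
      \<open>l = 0\<close> holds precisely when \<open>n = Suc j\<close>, that is, when
      \<open>i + 1\<close> is the final index \<open>n + 2\<close>.\<close>
    with i l eqs show "U (i + 1) = (if l = 0 then apps (church 0) (u # v # ws)
        else apps (App S2 (Const (XA (l - 1) u v ws))) (u # v # ws))"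
      by (cases "n = Suc j") (auto simp: U_def c_def)
  next
    show "U i \<succ> V i" if "i \<in> {1..n + 2}" for i using that by (rule red)
  qed (simp_all add: U_def V_def closed_stored stored_beta_eq)
qed

text \<open>One \<open>\<tau>\<close> has to serve all representatives of an integer, as a literal
  term. Two representatives of 1 force different values on it.\<close>

lemma not_storage_operator_witness: "\<not> storage_operator (witness :: 'c trm)"
proof
  define \<theta> :: "'c trm" where "\<theta> = Lam (Lam (App (Var 1) (App identity (Var 0))))"
  assume "storage_operator (witness :: 'c trm)"
  then obtain \<tau> :: "'c trm" where \<tau>: "\<And>t f. lambda_term t \<Longrightarrow> t \<simeq>\<^sub>\<beta> church 1 \<Longrightarrow> f \<notin> fv t \<Longrightarrow>
      App (App witness t) (Var f) \<succ> App (Var f) \<tau>"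
    unfolding storage_operator_def by blast
  have "App (App witness (church 1)) (Var 0) \<succ> App (Var 0) \<tau>"
    by (rule \<tau>) (simp_all add: lambda_term_def church_def)
  moreover have "App (App witness (church 1)) (Var 0) \<succ>
      App (Var 0) (App S2 (App baseB identity))"
  proof (rule head_red_trans[OF head_red_witness])
    have "App (App (App (church 1) stepA) baseB) (Var 0) \<succ> App (App stepA baseB) (Var 0)"
      unfolding church_def
      by (rule head_red_redex2, simp, rule head_red_redex1,
          simp add: lift_closed subst_closed closed_stepA)
    then show "App (App (App (church 1) stepA) baseB) (Var 0) \<succ>
        App (Var 0) (App S2 (App baseB identity))"
      by (rule head_red_trans) (rule head_red_stepA[OF closed_baseB(2)])
  qed
  ultimately have 1: "\<tau> = App S2 (App baseB identity)"
    by (rule head_red_App_Var_unique)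
  have "App identity (Var 0) \<simeq>\<^sub>\<beta> (Var 0 :: 'c trm)"
    unfolding identity_def by (rule beta_eq_redex) simp
  then have "\<theta> \<simeq>\<^sub>\<beta> church 1"
    unfolding \<theta>_def church_def by (auto intro!: beta_eq_Lam beta_eq_App)
  then have "App (App witness \<theta>) (Var 0) \<succ> App (Var 0) \<tau>"
    by (rule \<tau>[rotated]) (simp_all add: lambda_term_def \<theta>_def closed_identity)
  moreover have "App (App witness \<theta>) (Var 0) \<succ>
      App (Var 0) (App S2 (App (App identity baseB) identity))"
  proof (rule head_red_trans[OF head_red_witness])
    \<comment> \<open>The redex \<open>App identity baseB\<close> is in argument position, so head
      reduction carries it along uncontracted.\<close>
    have "App (App (App \<theta> stepA) baseB) (Var 0) \<succ> App (App stepA (App identity baseB)) (Var 0)"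
      unfolding \<theta>_def
      by (rule head_red_redex2, simp, rule head_red_redex1,
          simp add: lift_closed subst_closed closed_stepA closed_identity)
    then show "App (App (App \<theta> stepA) baseB) (Var 0) \<succ>
        App (Var 0) (App S2 (App (App identity baseB) identity))"
      by (rule head_red_trans) (rule head_red_stepA, simp add: closed_baseB closed_identity)
  qed
  ultimately have "\<tau> = App S2 (App (App identity baseB) identity)"
    by (rule head_red_App_Var_unique)
  \<comment> \<open>The two values would require \<open>baseB\<close>, an abstraction, to equal the
    application \<open>App identity baseB\<close>.\<close>
  with 1 show False by (simp add: baseB_def)
qed

theorem theorem3:
  "\<exists>T :: lambdaX_term. S_storage_operator S2 T \<and> \<not> storage_operator T"
  using S_storage_operator_witness not_storage_operator_witness by blast

end
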